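(* Let $X$ be any complex Banach space, let $\phi\in\mathcal{H}L_0(B_X,X)$ with $\phi(B_X)\subseteq B_X$ and consider the associated composition operator $C_\phi\colon\mathcal{H}L_0(B_X)\to\mathcal{H}L_0(B_X)$. If $\|\phi\|_\infty<1$, then $\lim_{n\to\infty}L\left(\phi^{(n)}\right)=0$. In other words, $\|C_\phi^{(n)}\|\to 0$.
   Context: $B_X$ denotes the open unit ball of $X$. $\mathcal{H}L_0(B_X,Y)$ is the Banach space of all holomorphic Lipschitz maps $f\colon B_X\to Y$ with $f(0)=0$, normed by the Lipschitz constant $L(f)=\sup_{x\neq y}\|f(x)-f(y)\|/\|x-y\|$; $\mathcal{H}L_0(B_X)=\mathcal{H}L_0(B_X,\mathbb C)$. $\|\phi\|_\infty=\sup_{x\in B_X}\|\phi(x)\|$. The composition operator is $C_\phi(f)=f\circ\phi$. $\phi^{(n)}=\phi\circ\cdots\circ\phi$ and $C_\phi^{(n)}=C_\phi\circ\cdots\circ C_\phi=C_{\phi^{(n)}}$ denote $n$-fold compositions; one has $\|C_\phi^{(n)}\|=L(\phi^{(n)})$. *)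

theory Defs
  imports "HOL-Analysis.Analysis"
begin

section \<open>Complex Banach spaces\<close>

text \<open>The underlying real normed structure is that of the library; the complex scalar
  multiplication extends the real one, and the norm is homogeneous over the complex numbers.\<close>

class complex_normed_vector = real_normed_vector +
  fixes scaleC :: "complex \<Rightarrow> 'a \<Rightarrow> 'a"  (infixr \<open>*\<^sub>C\<close> 75)
  assumes scaleC_add_right: "c *\<^sub>C (x + y) = c *\<^sub>C x + c *\<^sub>C y"
    and scaleC_add_left: "(c + d) *\<^sub>C x = c *\<^sub>C x + d *\<^sub>C x"
    and scaleC_scaleC: "c *\<^sub>C d *\<^sub>C x = (c * d) *\<^sub>C x"
    and scaleC_of_real: "complex_of_real r *\<^sub>C x = r *\<^sub>R x"
    and norm_scaleC: "norm (c *\<^sub>C x) = cmod c * norm x"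

lemma scaleC_one: "1 *\<^sub>C x = x" for x :: "'a::complex_normed_vector"
  using scaleC_of_real[of 1 x] by simp

class complex_banach = complex_normed_vector + banach

instantiation complex :: complex_banach
begin

definition scaleC_complex :: "complex \<Rightarrow> complex \<Rightarrow> complex"
  where "scaleC_complex c x = c * x"

instance
  by standard (simp_all add: scaleC_complex_def algebra_simps norm_mult scaleR_conv_of_real)

end

section \<open>Holomorphic Lipschitz maps on the open unit ball\<close>

text \<open>Holomorphy is complex Frechet differentiability at each point; \<^const>\<open>has_derivative\<close> already
  makes the derivative real-linear and bounded, so only complex homogeneity has to be added.\<close>

definition holomorphic_map_on ::
    "('a::complex_normed_vector \<Rightarrow> 'b::complex_normed_vector) \<Rightarrow> 'a set \<Rightarrow> bool"
  where "holomorphic_map_on f U \<longleftrightarrow>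
    (\<forall>x\<in>U. \<exists>D. (f has_derivative D) (at x) \<and> (\<forall>c v. D (c *\<^sub>C v) = c *\<^sub>C D v))"

lemma holomorphic_map_on_complex_iff:
  fixes f :: "complex \<Rightarrow> complex"
  assumes "open U"
  shows "holomorphic_map_on f U \<longleftrightarrow> f holomorphic_on U"
proof -
  have "(\<exists>D. (f has_derivative D) (at x) \<and> (\<forall>c v. D (c * v) = c * D v)) \<longleftrightarrow>
        (\<exists>d. (f has_field_derivative d) (at x))" for x
  proof
    assume "\<exists>D. (f has_derivative D) (at x) \<and> (\<forall>c v. D (c * v) = c * D v)"
    then obtain D where D: "(f has_derivative D) (at x)" "\<And>c v. D (c * v) = c * D v"
      by blast
    have "D = (*) (D 1)"
    proof
      show "D c = D 1 * c" for c
        using D(2)[of c 1] by (metis mult.commute mult_1_right)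
    qed
    with D(1) show "\<exists>d. (f has_field_derivative d) (at x)"
      unfolding has_field_derivative_def by metis
  next
    assume "\<exists>d. (f has_field_derivative d) (at x)"
    then show "\<exists>D. (f has_derivative D) (at x) \<and> (\<forall>c v. D (c * v) = c * D v)"
      unfolding has_field_derivative_def by (metis mult.left_commute)
  qed
  then show ?thesis
    using assms
    by (auto simp: holomorphic_map_on_def scaleC_complex_def holomorphic_on_open)
qed

text \<open>Maps on the ball are represented by total functions of which only the values on the ball
  matter; two of them stand for the same element of the space when they agree there.\<close>

definition HL0 :: "('a::complex_banach \<Rightarrow> 'b::complex_banach) set"
  where "HL0 = {f. f 0 = 0 \<and> holomorphic_map_on f (ball 0 1) \<and> (\<exists>C. C-lipschitz_on (ball 0 1) f)}"

text \<open>The pairs with \<open>x = y\<close> contribute \<open>0 / 0 = 0\<close>. They do not change the supremum, except that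
  they make the constant \<open>0\<close> when the space is trivial and there is no pair \<open>x \<noteq> y\<close>.\<close>

definition lip_const :: "('a::complex_banach \<Rightarrow> 'b::complex_banach) \<Rightarrow> real"
  where "lip_const f =
    (SUP (x, y) \<in> ball 0 1 \<times> ball 0 1. norm (f x - f y) / norm (x - y))"

definition ball_sup_norm :: "('a::complex_banach \<Rightarrow> 'b::complex_banach) \<Rightarrow> real"
  where "ball_sup_norm f = (SUP x\<in>ball 0 1. norm (f x))"

lemma bdd_above_lip_const:
  assumes "C-lipschitz_on (ball 0 1) f"
  shows "bdd_above ((\<lambda>(x, y). norm (f x - f y) / norm (x - y)) ` (ball 0 1 \<times> ball 0 1))"
proof (rule bdd_aboveI2)
  fix p :: "'a \<times> 'a" assume p: "p \<in> ball 0 1 \<times> ball 0 1"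
  obtain x y where xy: "p = (x, y)" by fastforce
  have "norm (f x - f y) \<le> C * norm (x - y)"
    using lipschitz_onD[OF assms, of x y] p xy by (simp add: dist_norm)
  then show "(case p of (x, y) \<Rightarrow> norm (f x - f y) / norm (x - y)) \<le> C"
    using lipschitz_on_nonneg[OF assms] xy by (cases "x = y") (auto simp: divide_le_eq)
qed

lemma lipschitz_on_lip_const:
  assumes "f \<in> HL0"
  shows "(lip_const f)-lipschitz_on (ball 0 1) f"
proof -
  obtain C where C: "C-lipschitz_on (ball 0 1) f"
    using assms by (auto simp: HL0_def)
  have le: "norm (f x - f y) / norm (x - y) \<le> lip_const f"
    if "x \<in> ball 0 1" "y \<in> ball 0 1" for x y
    unfolding lip_const_def
    using cSUP_upper[OF _ bdd_above_lip_const[OF C], of "(x, y)"] that by simp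
  show ?thesis
  proof (rule lipschitz_onI)
    fix x y :: 'a assume xy: "x \<in> ball 0 1" "y \<in> ball 0 1"
    show "dist (f x) (f y) \<le> lip_const f * dist x y"
      using le[OF xy] by (cases "x = y") (auto simp: dist_norm divide_le_eq)
  next
    show "0 \<le> lip_const f" using le[of 0 0] by simp
  qed
qed

lemma lip_const_le:
  fixes f :: "'a::complex_banach \<Rightarrow> 'b::complex_banach"
  assumes "C-lipschitz_on (ball 0 1) f"
  shows "lip_const f \<le> C"
  unfolding lip_const_def
proof (rule cSUP_least)
  fix p :: "'a \<times> 'a" assume p: "p \<in> ball 0 1 \<times> ball 0 1"
  obtain x y where xy: "p = (x, y)" by fastforce
  have "norm (f x - f y) \<le> C * norm (x - y)"
    using lipschitz_onD[OF assms, of x y] p xy by (simp add: dist_norm)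
  then show "(case p of (x, y) \<Rightarrow> norm (f x - f y) / norm (x - y)) \<le> C"
    using lipschitz_on_nonneg[OF assms] xy by (cases "x = y") (auto simp: divide_le_eq)
qed auto

section \<open>Composition operators\<close>

definition comp_operator ::
    "('a::complex_banach \<Rightarrow> 'a) \<Rightarrow> ('a \<Rightarrow> complex) \<Rightarrow> ('a \<Rightarrow> complex)"
  where "comp_operator \<phi> f = f \<circ> \<phi>"

text \<open>The operator norm on the space \<^const>\<open>HL0\<close> normed by \<^const>\<open>lip_const\<close>, in the form that
  \<^const>\<open>onorm\<close> has for normed types, again with \<open>0 / 0 = 0\<close>.\<close>

definition HL0_onorm :: "(('a::complex_banach \<Rightarrow> complex) \<Rightarrow> ('a \<Rightarrow> complex)) \<Rightarrow> real"
  where "HL0_onorm T = (SUP f\<in>HL0. lip_const (T f) / lip_const f)"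

lemma HL0_compose:
  fixes \<phi> :: "'a::complex_banach \<Rightarrow> 'a" and f :: "'a \<Rightarrow> 'b::complex_banach"
  assumes f: "f \<in> HL0" and \<phi>: "\<phi> \<in> HL0" "\<phi> ` ball 0 1 \<subseteq> ball 0 1"
  shows "f \<circ> \<phi> \<in> HL0"
proof -
  have "holomorphic_map_on (f \<circ> \<phi>) (ball 0 1)"
    unfolding holomorphic_map_on_def
  proof
    fix x :: 'a assume x: "x \<in> ball 0 1"
    obtain D where D: "(\<phi> has_derivative D) (at x)" "\<And>c v. D (c *\<^sub>C v) = c *\<^sub>C D v"
      using \<phi>(1) x unfolding HL0_def holomorphic_map_on_def by blast
    have "\<phi> x \<in> ball 0 1" using \<phi>(2) x by blast
    then obtain E where E: "(f has_derivative E) (at (\<phi> x))" "\<And>c v. E (c *\<^sub>C v) = c *\<^sub>C E v"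
      using f unfolding HL0_def holomorphic_map_on_def by blast
    have "(f \<circ> \<phi> has_derivative E \<circ> D) (at x)"
      by (rule diff_chain_at[OF D(1) E(1)])
    then show "\<exists>D. (f \<circ> \<phi> has_derivative D) (at x) \<and> (\<forall>c v. D (c *\<^sub>C v) = c *\<^sub>C D v)"
      using D(2) E(2) by (intro exI[of _ "E \<circ> D"]) simp
  qed
  moreover have "(lip_const f * lip_const \<phi>)-lipschitz_on (ball 0 1) (f \<circ> \<phi>)"
    using lipschitz_on_compose[OF lipschitz_on_lip_const[OF \<phi>(1)],
        OF lipschitz_on_subset[OF lipschitz_on_lip_const[OF f] \<phi>(2)]] .
  ultimately show ?thesis
    using f \<phi>(1) unfolding HL0_def by auto
qed

lemma comp_operator_HL0:
  assumes "\<phi> \<in> HL0" "\<phi> ` ball 0 1 \<subseteq> ball 0 1"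
  shows "comp_operator \<phi> ` HL0 \<subseteq> HL0"
  using HL0_compose[OF _ assms] by (auto simp: comp_operator_def)

lemma comp_operator_funpow: "(comp_operator \<phi> ^^ n) f = f \<circ> (\<phi> ^^ n)"
proof (induction n arbitrary: f)
  case (Suc n)
  then show ?case
    by (simp only: funpow.simps comp_operator_def o_apply) (simp add: fun_eq_iff funpow_swap1)
qed auto

end

theory Submission
  imports Defs "HOL-Complex_Analysis.Conformal_Mappings"
begin

text \<open>Fix \<open>c < 1\<close> with \<open>\<phi>\<close> mapping the unit ball into the ball of radius \<open>c\<close>. The Schwarz lemma
  gives \<open>norm (\<phi> x) \<le> c * norm x\<close>, so the iterates \<open>\<phi> ^^ n\<close> tend to \<open>0\<close> uniformly, at the rate
  \<open>c ^ n\<close>. Cauchy's estimate on discs of radius \<open>1 - c\<close> turns this into a bound for derivatives: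
  on the smaller ball of radius \<open>c\<close> the map \<open>\<phi> ^^ n\<close> has Lipschitz constant at most
  \<open>c ^ n / (1 - c)\<close>. The first application of \<open>\<phi>\<close> moves the whole unit ball into that smaller
  ball, so the Lipschitz constant of \<open>\<phi> ^^ Suc n = (\<phi> ^^ n) \<circ> \<phi>\<close> is at most
  \<open>c ^ n / (1 - c)\<close> times that of \<open>\<phi>\<close>. The operator norm of composition with \<open>\<phi> ^^ n\<close> is
  at most the Lipschitz constant of \<open>\<phi> ^^ n\<close>, so it tends to \<open>0\<close> as well.

  Schwarz's lemma and Cauchy's estimate for maps between Banach spaces follow from the classical
  ones: restrict the map to a complex line and compose it with a norming functional at the vector
  whose norm has to be estimated. Norming functionals come from the Hahn-Banach theorem, which is
  proved here by observing that a minimal sublinear functional is linear.\<close>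

section \<open>Norming functionals\<close>

definition sublinear :: "('a::real_vector \<Rightarrow> real) \<Rightarrow> bool"
  where "sublinear q \<longleftrightarrow>
    (\<forall>x y. q (x + y) \<le> q x + q y) \<and> (\<forall>t>0. \<forall>x. q (t *\<^sub>R x) = t * q x)"

lemma sublinear_add: "sublinear q \<Longrightarrow> q (x + y) \<le> q x + q y"
  by (simp add: sublinear_def)

lemma sublinear_scaleR_pos: "sublinear q \<Longrightarrow> t > 0 \<Longrightarrow> q (t *\<^sub>R x) = t * q x"
  by (simp add: sublinear_def)

lemma sublinear_zero:
  assumes "sublinear q"
  shows "q 0 = 0"
  using sublinear_scaleR_pos[OF assms, of 2 0] by simp

lemma sublinear_scaleR: "sublinear q \<Longrightarrow> t \<ge> 0 \<Longrightarrow> q (t *\<^sub>R x) = t * q x"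
  by (cases "t = 0") (simp_all add: sublinear_zero sublinear_scaleR_pos)

lemma sublinear_minus: "sublinear q \<Longrightarrow> - q (- x) \<le> q x"
  using sublinear_add[of q x "- x"] by (simp add: sublinear_zero)

text \<open>One inequality of positive homogeneity suffices, as the scalar can be inverted.\<close>

lemma sublinearI:
  assumes "\<And>x y. q (x + y) \<le> q x + q y"
    and le: "\<And>t x. t > 0 \<Longrightarrow> q (t *\<^sub>R x) \<le> t * q x"
  shows "sublinear q"
proof -
  have "t * q x \<le> q (t *\<^sub>R x)" if "t > 0" for t x
    using le[of "inverse t" "t *\<^sub>R x"] that by (simp add: field_simps)
  with assms show ?thesis
    unfolding sublinear_def by (meson order.antisym)
qed

text \<open>The largest sublinear functional \<open>r\<close> below \<open>q\<close> with \<open>r (x + t *\<^sub>R y) = r x + t * q y\<close>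
  for \<open>t \<ge> 0\<close>: passing to it makes \<open>q\<close> linear in the direction of \<open>y\<close>.\<close>

definition linearize :: "('a::real_vector \<Rightarrow> real) \<Rightarrow> 'a \<Rightarrow> 'a \<Rightarrow> real"
  where "linearize q y x = (INF t\<in>{0..}. q (x + t *\<^sub>R y) - t * q y)"

lemma linearize_le:
  assumes "sublinear q" "t \<ge> 0"
  shows "linearize q y x \<le> q (x + t *\<^sub>R y) - t * q y"
proof -
  have "- q (- x) \<le> q (x + s *\<^sub>R y) - s * q y" if "s \<ge> 0" for s
    using sublinear_add[OF assms(1), of "x + s *\<^sub>R y" "- x"] sublinear_scaleR[OF assms(1) that, of y]
    by simp
  then have "bdd_below ((\<lambda>t. q (x + t *\<^sub>R y) - t * q y) ` {0..})"
    by (intro bdd_belowI2) auto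
  from cINF_lower[OF this] assms(2) show ?thesis
    by (simp add: linearize_def)
qed

lemma linearize_greatest:
  "(\<And>t. t \<ge> 0 \<Longrightarrow> b \<le> q (x + t *\<^sub>R y) - t * q y) \<Longrightarrow> b \<le> linearize q y x"
  unfolding linearize_def by (rule cINF_greatest) auto

lemma sublinear_linearize:
  assumes q: "sublinear q"
  shows "sublinear (linearize q y)"
proof (rule sublinearI)
  fix x z
  have "linearize q y (x + z) - (q (z + s *\<^sub>R y) - s * q y) \<le> q (x + t *\<^sub>R y) - t * q y"
    if "s \<ge> 0" "t \<ge> 0" for s t
    using linearize_le[OF q, of "t + s" y "x + z"] that
      sublinear_add[OF q, of "x + t *\<^sub>R y" "z + s *\<^sub>R y"]
    by (simp add: algebra_simps)
  then have "linearize q y (x + z) - (q (z + s *\<^sub>R y) - s * q y) \<le> linearize q y x"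
    if "s \<ge> 0" for s
    using that by (intro linearize_greatest) auto
  then have "linearize q y (x + z) - linearize q y x \<le> linearize q y z"
    by (intro linearize_greatest) (simp add: algebra_simps)
  then show "linearize q y (x + z) \<le> linearize q y x + linearize q y z"
    by simp
next
  fix t :: real and x assume t: "t > 0"
  have "linearize q y (t *\<^sub>R x) / t \<le> q (x + s *\<^sub>R y) - s * q y" if "s \<ge> 0" for s
  proof -
    have "linearize q y (t *\<^sub>R x) \<le> q (t *\<^sub>R (x + s *\<^sub>R y)) - (t * s) * q y"
      using linearize_le[OF q, of "t * s" y "t *\<^sub>R x"] t that
      by (simp add: scaleR_add_right mult.assoc)
    also have "\<dots> = t * (q (x + s *\<^sub>R y) - s * q y)"
      unfolding sublinear_scaleR_pos[OF q t] by (simp add: right_diff_distrib mult.assoc)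
    finally show ?thesis
      using t by (simp add: divide_le_eq mult.commute)
  qed
  then have "linearize q y (t *\<^sub>R x) / t \<le> linearize q y x"
    by (rule linearize_greatest)
  then show "linearize q y (t *\<^sub>R x) \<le> t * linearize q y x"
    using t by (simp add: divide_le_eq mult.commute)
qed

lemma linearize_le_self: "sublinear q \<Longrightarrow> linearize q y \<le> q"
  using linearize_le[of q 0 y] by (simp add: le_fun_def)

lemma linearize_minus_le:
  assumes "sublinear q"
  shows "linearize q y (- y) \<le> - q y"
  using linearize_le[OF assms, of 1 y "- y"] sublinear_zero[OF assms] by simp

text \<open>If \<open>q\<close> is minimal then \<open>linearize q y = q\<close>, which says that \<open>q\<close> is superadditive.\<close>

lemma minimal_sublinear_imp_linear:
  assumes q: "sublinear q" and min: "\<And>r. sublinear r \<Longrightarrow> r \<le> q \<Longrightarrow> r = q"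
  shows "linear q"
proof -
  have lin: "linearize q y = q" for y
    using min[OF sublinear_linearize[OF q] linearize_le_self[OF q]] .
  have add: "q (x + y) = q x + q y" for x y
    using linearize_le[OF q, of 1 y x] sublinear_add[OF q, of x y] lin by simp
  have minus: "q (- x) = - q x" for x
    using add[of x "- x"] sublinear_zero[OF q] by simp
  have "q (t *\<^sub>R x) = t * q x" for t x
  proof (cases "t \<ge> 0")
    case True
    then show ?thesis by (rule sublinear_scaleR[OF q])
  next
    case False
    then have "q (- (t *\<^sub>R x)) = - t * q x"
      using sublinear_scaleR[OF q, of "- t" x] by simp
    then show ?thesis using minus by simp
  qed
  with add show ?thesis by (intro linearI) simp_all
qed

text \<open>The pointwise infimum of a chain of sublinear functionals is subadditive because any two
  members of the chain can be replaced by the smaller one of them.\<close>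

lemma sublinear_chain_Inf:
  assumes ne: "C \<noteq> {}" and sub: "\<And>q. q \<in> C \<Longrightarrow> sublinear q \<and> q \<le> p"
    and chain: "\<And>q r. q \<in> C \<Longrightarrow> r \<in> C \<Longrightarrow> q \<le> r \<or> r \<le> q"
  shows "sublinear (\<lambda>x. INF q\<in>C. q x) \<and> (\<forall>q\<in>C. (\<lambda>x. INF q\<in>C. q x) \<le> q)"
proof -
  define u where "u x = (INF q\<in>C. q x)" for x
  have "bdd_below ((\<lambda>q. q x) ` C)" for x
  proof (rule bdd_belowI2)
    fix q assume "q \<in> C"
    then show "- p (- x) \<le> q x"
      using sub[of q] sublinear_minus[of q x] by (force simp: le_fun_def dest: spec[of _ "- x"])
  qed
  then have le: "u x \<le> q x" if "q \<in> C" for q x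
    unfolding u_def using that by (rule cINF_lower)
  have greatest: "b \<le> u x" if "\<And>q. q \<in> C \<Longrightarrow> b \<le> q x" for b x
    unfolding u_def using ne that by (rule cINF_greatest)
  have "sublinear u"
  proof (rule sublinearI)
    fix x y
    have "u (x + y) \<le> q x + r y" if "q \<in> C" "r \<in> C" for q r
      using chain[OF that]
    proof
      assume "q \<le> r"
      then show ?thesis
        using le[OF that(1), of "x + y"] sublinear_add[of q x y] sub[OF that(1)]
        by (auto simp: le_fun_def intro: order_trans add_left_mono)
    next
      assume "r \<le> q"
      then show ?thesis
        using le[OF that(2), of "x + y"] sublinear_add[of r x y] sub[OF that(2)]
        by (auto simp: le_fun_def intro: order_trans add_right_mono)
    qed
    then have "u (x + y) - r y \<le> u x" if "r \<in> C" for r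
      using that by (intro greatest) (simp add: algebra_simps)
    then have "u (x + y) - u x \<le> u y"
      by (intro greatest) (simp add: algebra_simps)
    then show "u (x + y) \<le> u x + u y" by simp
  next
    fix t :: real and x assume t: "t > 0"
    have "u (t *\<^sub>R x) / t \<le> q x" if "q \<in> C" for q
      using le[OF that, of "t *\<^sub>R x"] sublinear_scaleR_pos[of q t x] sub[OF that] t
      by (simp add: divide_le_eq mult.commute)
    then have "u (t *\<^sub>R x) / t \<le> u x" by (rule greatest)
    then show "u (t *\<^sub>R x) \<le> t * u x"
      using t by (simp add: divide_le_eq mult.commute)
  qed
  with le show ?thesis
    unfolding u_def by (simp add: le_fun_def)
qed

lemma sublinear_dominates_linear:
  assumes p: "sublinear p"
  obtains q where "linear q" "q \<le> p"
proof -
  define A where "A = {q. sublinear q \<and> q \<le> p}"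
  have "\<exists>m\<in>A. \<forall>a\<in>A. m \<ge> a \<longrightarrow> a = m"
  proof (rule predicate_Zorn)
    show "partial_order_on A (relation_of (\<ge>) A)"
      by (rule partial_order_on_relation_ofI) auto
  next
    fix C assume "C \<in> Chains (relation_of (\<ge>) A)"
    then have C: "q \<in> C \<Longrightarrow> r \<in> C \<Longrightarrow> q \<in> A \<and> (q \<le> r \<or> r \<le> q)" for q r
      unfolding Chains_def relation_of_def by auto
    show "\<exists>u\<in>A. \<forall>a\<in>C. u \<le> a"
    proof (cases "C = {}")
      case True
      with p show ?thesis by (auto simp: A_def)
    next
      case False
      define u where "u x = (INF q\<in>C. q x)" for x
      have u: "sublinear u" "\<forall>q\<in>C. u \<le> q"
        using sublinear_chain_Inf[OF False, of p] C unfolding A_def u_def[abs_def] by blast+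
      obtain q where "q \<in> C" using False by blast
      with u(2) C have "u \<le> p"
        unfolding A_def by (metis (mono_tags, lifting) mem_Collect_eq order_trans)
      with u show ?thesis by (auto simp: A_def)
    qed
  qed
  then obtain m where m: "sublinear m" "m \<le> p" "\<And>a. sublinear a \<Longrightarrow> a \<le> m \<Longrightarrow> a = m"
    unfolding A_def by (metis (mono_tags, lifting) mem_Collect_eq order_trans)
  then show thesis
    using that minimal_sublinear_imp_linear by blast
qed

text \<open>Linearizing the norm in the direction of \<open>y\<close> first forces \<open>q (- y) \<le> - norm y\<close> for every
  linear \<open>q\<close> below the result, so \<open>q\<close> attains the norm of \<open>y\<close>.\<close>

lemma real_norming_functional:
  fixes y :: "'a::real_normed_vector"
  obtains q where "linear q" "\<And>x. q x \<le> norm x" "q y = norm y"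
proof -
  have norm: "sublinear (norm :: 'a \<Rightarrow> real)"
    by (auto simp: sublinear_def norm_triangle_ineq)
  obtain q where q: "linear q" "q \<le> linearize norm y"
    using sublinear_dominates_linear[OF sublinear_linearize[OF norm]] by blast
  have le: "q x \<le> norm x" for x
    using q(2) linearize_le_self[OF norm, of y] by (meson le_funD order_trans)
  have "q (- y) \<le> - norm y"
    using q(2) linearize_minus_le[OF norm, of y] by (meson le_funD order_trans)
  then have "q y = norm y"
    using le[of y] linear_neg[OF q(1), of y] by simp
  with q(1) le show thesis using that by blast
qed

lemma scaleC_scaleR: "c *\<^sub>C (r *\<^sub>R x) = r *\<^sub>R (c *\<^sub>C x)" for x :: "'a::complex_normed_vector"
  by (simp flip: scaleC_of_real add: scaleC_scaleC mult.commute)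

text \<open>A real functional \<open>q\<close> is the real part of the complex functional
  \<open>\<lambda>x. q x - \<i> * q (\<i> *\<^sub>C x)\<close>. Rotating \<open>x\<close> so that the value at \<open>x\<close> becomes nonnegative shows that
  the complex functional has the same bound.\<close>

lemma complex_norming_functional:
  fixes y :: "'a::complex_normed_vector"
  obtains l :: "'a \<Rightarrow> complex" where "bounded_linear l" "\<And>c x. l (c *\<^sub>C x) = c * l x"
    "\<And>x. norm (l x) \<le> norm x" "norm (l y) = norm y"
proof -
  obtain q where q: "linear q" "\<And>x. q x \<le> norm x" "q y = norm y"
    using real_norming_functional[of y] by blast
  define l where "l x = Complex (q x) (- q (\<i> *\<^sub>C x))" for x
  have add: "l (x + z) = l x + l z" for x z
    by (simp add: l_def complex_eq_iff scaleC_add_right linear_add[OF q(1)])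
  have real: "l (r *\<^sub>R x) = r *\<^sub>R l x" for r x
    by (simp add: l_def complex_eq_iff scaleC_scaleR linear_cmul[OF q(1)])
  have imag: "l (\<i> *\<^sub>C x) = \<i> * l x" for x
  proof -
    have "\<i> *\<^sub>C \<i> *\<^sub>C x = - x"
      using scaleC_of_real[of "-1" x] by (simp add: scaleC_scaleC)
    then show ?thesis
      by (simp add: l_def complex_eq_iff linear_neg[OF q(1)])
  qed
  have hom: "l (c *\<^sub>C x) = c * l x" for c x
  proof -
    have "c *\<^sub>C x = Re c *\<^sub>R x + Im c *\<^sub>R (\<i> *\<^sub>C x)"
      by (subst complex_eq[of c])
        (simp add: scaleC_add_left scaleC_scaleC mult.commute flip: scaleC_of_real)
    then show ?thesis
      by (simp add: add real imag complex_eq_iff)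
  qed
  have le: "norm (l x) \<le> norm x" for x
  proof (cases "l x = 0")
    case False
    define c where "c = cnj (l x) / norm (l x)"
    have c: "norm c = 1" "c * l x = norm (l x)"
      using False complex_norm_square[of "l x"]
      by (simp_all add: c_def norm_divide field_simps power2_eq_square)
    have "norm (l x) = q (c *\<^sub>C x)"
      using arg_cong[OF c(2), of Re] arg_cong[OF hom[of c x], of Re] by (simp add: l_def)
    also have "\<dots> \<le> norm x"
      using q(2)[of "c *\<^sub>C x"] c(1) by (simp add: norm_scaleC)
    finally show ?thesis .
  qed simp
  have "norm y \<le> norm (l y)"
    using abs_Re_le_cmod[of "l y"] q(3) by (simp add: l_def)
  then have "norm (l y) = norm y"
    using le[of y] by simp
  moreover have "bounded_linear l"
    using add real le by (intro bounded_linear_intro[where K = 1]) simp_all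
  ultimately show thesis
    using that hom le by blast
qed

section \<open>Schwarz's lemma and Cauchy's estimate on the unit ball\<close>

lemma holomorphic_slice:
  fixes f :: "'a::complex_normed_vector \<Rightarrow> 'b::complex_normed_vector" and l :: "'b \<Rightarrow> complex"
  assumes D: "(f has_derivative D) (at (x + \<zeta> *\<^sub>C v))" "\<And>c w. D (c *\<^sub>C w) = c *\<^sub>C D w"
    and l: "bounded_linear l" "\<And>c w. l (c *\<^sub>C w) = c * l w"
  shows "((\<lambda>\<zeta>. l (f (x + \<zeta> *\<^sub>C v))) has_field_derivative l (D v)) (at \<zeta>)"
proof -
  have "bounded_linear (\<lambda>\<zeta>. \<zeta> *\<^sub>C v)"
    by (rule bounded_linear_intro[where K = "norm v"])
      (simp_all add: scaleC_add_left norm_scaleC scaleR_conv_of_real flip: scaleC_scaleC scaleC_of_real)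
  then have "((\<lambda>\<zeta>. x + \<zeta> *\<^sub>C v) has_derivative (\<lambda>\<zeta>. \<zeta> *\<^sub>C v)) (at \<zeta>)"
    by (auto intro!: derivative_eq_intros bounded_linear_imp_has_derivative)
  from has_derivative_compose[OF this D(1)]
  have "((\<lambda>\<zeta>. l (f (x + \<zeta> *\<^sub>C v))) has_derivative (\<lambda>\<zeta>. l (D (\<zeta> *\<^sub>C v)))) (at \<zeta>)"
    by (rule bounded_linear.has_derivative[OF l(1)])
  moreover have "(\<lambda>\<zeta>. l (D (\<zeta> *\<^sub>C v))) = (*) (l (D v))"
    by (simp add: fun_eq_iff D(2) l(2))
  ultimately show ?thesis
    by (simp add: has_field_derivative_def)
qed

lemma holomorphic_map_Schwarz:
  fixes f :: "'a::complex_normed_vector \<Rightarrow> 'b::complex_normed_vector"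
  assumes hol: "holomorphic_map_on f (ball 0 1)" and f0: "f 0 = 0"
    and bound: "\<And>x. norm x < 1 \<Longrightarrow> norm (f x) < c" and x: "norm x < 1"
  shows "norm (f x) \<le> c * norm x"
proof (cases "x = 0")
  case False
  have c: "c > 0" using bound[of 0] f0 by simp
  obtain l :: "'b \<Rightarrow> complex" where l: "bounded_linear l" "\<And>c w. l (c *\<^sub>C w) = c * l w"
    "\<And>w. norm (l w) \<le> norm w" "norm (l (f x)) = norm (f x)"
    using complex_norming_functional[of "f x"] by blast
  define v where "v = (1 / norm x) *\<^sub>R x"
  have v: "norm v = 1" "complex_of_real (norm x) *\<^sub>C v = x"
    using False by (simp_all add: v_def scaleC_of_real)
  define g where "g \<zeta> = l (f (0 + \<zeta> *\<^sub>C v)) / c" for \<zeta>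
  have "g holomorphic_on ball 0 1"
    unfolding g_def
  proof (rule holomorphic_on_divide)
    show "(\<lambda>\<zeta>. l (f (0 + \<zeta> *\<^sub>C v))) holomorphic_on ball 0 1"
      unfolding holomorphic_on_open[OF open_ball]
    proof
      fix \<zeta> :: complex assume "\<zeta> \<in> ball 0 1"
      then have "0 + \<zeta> *\<^sub>C v \<in> ball 0 1" by (simp add: norm_scaleC v(1))
      then obtain D where D: "(f has_derivative D) (at (0 + \<zeta> *\<^sub>C v))"
          "\<And>c w. D (c *\<^sub>C w) = c *\<^sub>C D w"
        using hol unfolding holomorphic_map_on_def by blast
      show "\<exists>d. ((\<lambda>\<zeta>. l (f (0 + \<zeta> *\<^sub>C v))) has_field_derivative d) (at \<zeta>)"
        using holomorphic_slice[OF D l(1,2)] by blast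
    qed
  qed (use c in auto)
  moreover have "g 0 = 0"
    using scaleC_of_real[of 0 v] f0 linear_0[OF bounded_linear.linear[OF l(1)]] by (simp add: g_def)
  moreover have "norm (g \<zeta>) < 1" if "norm \<zeta> < 1" for \<zeta>
  proof -
    have "norm (l (f (\<zeta> *\<^sub>C v))) < c"
      using l(3) bound[of "\<zeta> *\<^sub>C v"] that by (metis norm_scaleC v(1) mult_1_right order_le_less_trans)
    then show ?thesis using c by (simp add: g_def norm_divide)
  qed
  ultimately have "norm (g (norm x)) \<le> norm (complex_of_real (norm x))"
    using x by (intro Schwarz_Lemma(1)) auto
  then show ?thesis
    using c l(4) by (simp add: g_def v(2) norm_divide divide_le_eq mult.commute)
qed (simp add: f0)

text \<open>Cauchy's estimate bounds the derivative in the direction of \<open>v\<close> by means of the disc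
  \<open>{x + \<zeta> *\<^sub>C v | norm \<zeta> \<le> s / norm v}\<close>, which stays within the unit ball.\<close>

lemma holomorphic_map_Cauchy_estimate:
  fixes f :: "'a::complex_normed_vector \<Rightarrow> 'b::complex_normed_vector"
  assumes hol: "holomorphic_map_on f (ball 0 1)"
    and bound: "\<And>x. norm x < 1 \<Longrightarrow> norm (f x) \<le> M"
    and s: "s > 0" "norm x + s < 1"
    and D: "(f has_derivative D) (at x)" "\<And>c w. D (c *\<^sub>C w) = c *\<^sub>C D w"
  shows "norm (D v) \<le> M / s * norm v"
proof (cases "v = 0")
  case True
  then show ?thesis
    using linear_0[OF has_derivative_linear[OF D(1)]] by simp
next
  case False
  obtain l :: "'b \<Rightarrow> complex" where l: "bounded_linear l" "\<And>c w. l (c *\<^sub>C w) = c * l w"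
    "\<And>w. norm (l w) \<le> norm w" "norm (l (D v)) = norm (D v)"
    using complex_norming_functional[of "D v"] by blast
  define r where "r = s / norm v"
  define g where "g \<zeta> = l (f (x + \<zeta> *\<^sub>C v))" for \<zeta>
  have r: "r > 0" using s False by (simp add: r_def)
  have disc: "norm (x + \<zeta> *\<^sub>C v) < 1" if "norm \<zeta> \<le> r" for \<zeta>
  proof -
    have "norm \<zeta> * norm v \<le> s"
      using that False by (simp add: r_def le_divide_eq)
    then show ?thesis
      using norm_triangle_ineq[of x "\<zeta> *\<^sub>C v"] s(2) by (simp add: norm_scaleC)
  qed
  have "\<exists>d. (g has_field_derivative d) (at \<zeta>)" if "\<zeta> \<in> cball 0 r" for \<zeta>
  proof -
    have "x + \<zeta> *\<^sub>C v \<in> ball 0 1" using disc that by simp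
    then obtain E where E: "(f has_derivative E) (at (x + \<zeta> *\<^sub>C v))"
        "\<And>c w. E (c *\<^sub>C w) = c *\<^sub>C E w"
      using hol unfolding holomorphic_map_on_def by blast
    show ?thesis
      unfolding g_def using holomorphic_slice[OF E l(1,2)] by blast
  qed
  then have hol_g: "g holomorphic_on cball 0 r"
    by (meson field_differentiable_at_within field_differentiable_def holomorphic_onI)
  have "norm (g \<zeta>) \<le> M" if "norm (0 - \<zeta>) = r" for \<zeta>
    using l(3) bound[OF disc[of \<zeta>]] that unfolding g_def
    by (metis order_trans order_refl diff_0 norm_minus_cancel)
  from Cauchy_inequality[of g 0 r M 1, OF _ holomorphic_on_imp_continuous_on[OF hol_g] r this]
  have "norm (deriv g 0) \<le> M / r"
    using holomorphic_on_subset[OF hol_g ball_subset_cball] by simp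
  moreover have "deriv g 0 = l (D v)"
  proof -
    have "x + 0 *\<^sub>C v = x" using scaleC_of_real[of 0 v] by simp
    then show ?thesis
      using holomorphic_slice[of f D x 0 v l] D l(1,2) unfolding g_def by (simp add: DERIV_imp_deriv)
  qed
  ultimately show ?thesis
    using l(4) by (simp add: r_def)
qed

lemma holomorphic_map_lipschitz_on_ball:
  fixes f :: "'a::complex_normed_vector \<Rightarrow> 'b::complex_normed_vector"
  assumes hol: "holomorphic_map_on f (ball 0 1)"
    and bound: "\<And>x. norm x < 1 \<Longrightarrow> norm (f x) \<le> M"
    and c: "c < 1"
  shows "(M / (1 - c))-lipschitz_on (ball 0 c) f"
proof (rule lipschitz_onI)
  have M: "0 \<le> M" using order_trans[OF norm_ge_zero bound[of 0]] by simp
  then show "0 \<le> M / (1 - c)" using c by simp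
  obtain D where D: "\<And>x. norm x < 1 \<Longrightarrow> (f has_derivative D x) (at x)"
      "\<And>x k w. norm x < 1 \<Longrightarrow> D x (k *\<^sub>C w) = k *\<^sub>C D x w"
    using hol unfolding holomorphic_map_on_def by (metis mem_ball_0)
  fix x y :: 'a assume "x \<in> ball 0 c" "y \<in> ball 0 c"
  then show "dist (f x) (f y) \<le> M / (1 - c) * dist x y"
    unfolding dist_norm
  proof (rule differentiable_bound[OF convex_ball, rotated -2])
    fix z :: 'a assume z: "z \<in> ball 0 c"
    then have z1: "norm z < 1" "norm z + (1 - c) < 1" using c by simp_all
    show "(f has_derivative D z) (at z within ball 0 c)"
      using D(1)[OF z1(1)] by (rule has_derivative_at_withinI)
    show "onorm (D z) \<le> M / (1 - c)"
      using holomorphic_map_Cauchy_estimate[OF hol bound _ z1(2) D(1)[OF z1(1)] D(2)[OF z1(1)]] c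
      by (intro onorm_bound) (simp_all add: M)
  qed
qed

section \<open>Iterates and composition operators\<close>

lemma id_HL0: "id \<in> HL0"
proof -
  have "holomorphic_map_on id (ball 0 1)"
    unfolding holomorphic_map_on_def by (auto intro!: exI[of _ id] derivative_eq_intros simp: id_def)
  moreover have "1-lipschitz_on (ball 0 1) id"
    by (auto intro: lipschitz_onI)
  ultimately show ?thesis by (auto simp: HL0_def)
qed

lemma funpow_HL0:
  fixes \<phi> :: "'a::complex_banach \<Rightarrow> 'a"
  assumes "\<phi> \<in> HL0" "\<phi> ` ball 0 1 \<subseteq> ball 0 1"
  shows "\<phi> ^^ n \<in> HL0 \<and> (\<phi> ^^ n) ` ball 0 1 \<subseteq> ball 0 1"
proof (induction n)
  case 0
  show ?case using id_HL0 by (simp add: id_def)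
next
  case (Suc n)
  then show ?case
    using HL0_compose[of \<phi> "\<phi> ^^ n"] assms by (auto simp: image_subset_iff o_def)
qed

lemma lip_const_nonneg: "f \<in> HL0 \<Longrightarrow> 0 \<le> lip_const f"
  by (rule lipschitz_on_nonneg[OF lipschitz_on_lip_const])

text \<open>Composition with \<open>\<phi>\<close> multiplies Lipschitz constants by at most \<open>lip_const \<phi>\<close>. The zero
  function shows that the supremum defining the operator norm is nonnegative.\<close>

lemma HL0_onorm_comp_operator:
  fixes \<phi> :: "'a::complex_banach \<Rightarrow> 'a"
  assumes \<phi>: "\<phi> \<in> HL0" "\<phi> ` ball 0 1 \<subseteq> ball 0 1"
  shows "0 \<le> HL0_onorm (comp_operator \<phi>)" "HL0_onorm (comp_operator \<phi>) \<le> lip_const \<phi>"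
proof -
  have le: "lip_const (comp_operator \<phi> f) / lip_const f \<le> lip_const \<phi>" if f: "f \<in> HL0" for f
  proof -
    have "(lip_const f * lip_const \<phi>)-lipschitz_on (ball 0 1) (f \<circ> \<phi>)"
      using lipschitz_on_compose[OF lipschitz_on_lip_const[OF \<phi>(1)],
          OF lipschitz_on_subset[OF lipschitz_on_lip_const[OF f] \<phi>(2)]] .
    from lip_const_le[OF this] show ?thesis
      using lip_const_nonneg[OF f] lip_const_nonneg[OF \<phi>(1)]
      by (cases "lip_const f = 0") (simp_all add: comp_operator_def divide_le_eq mult.commute)
  qed
  have zero: "(\<lambda>_. 0) \<in> (HL0 :: ('a \<Rightarrow> complex) set)"
  proof -
    have "holomorphic_map_on (\<lambda>_. 0 :: complex) (ball (0 :: 'a) 1)"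
      unfolding holomorphic_map_on_def
      by (auto intro!: exI[of _ "\<lambda>_. 0"] simp: scaleC_complex_def)
    moreover have "0-lipschitz_on (ball (0 :: 'a) 1) (\<lambda>_. 0 :: complex)"
      by (auto intro: lipschitz_onI)
    ultimately show ?thesis by (auto simp: HL0_def)
  qed
  show "HL0_onorm (comp_operator \<phi>) \<le> lip_const \<phi>"
    unfolding HL0_onorm_def using zero le by (intro cSUP_least) auto
  have "0 \<le> lip_const (comp_operator \<phi> (\<lambda>_. 0)) / lip_const (\<lambda>_::'a. 0::complex)"
    using lip_const_nonneg[OF zero] by (simp add: comp_operator_def o_def)
  also have "\<dots> \<le> HL0_onorm (comp_operator \<phi>)"
    unfolding HL0_onorm_def using le by (intro cSUP_upper[OF zero] bdd_aboveI2)
  finally show "0 \<le> HL0_onorm (comp_operator \<phi>)" .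
qed

lemma comp_operator_power: "comp_operator \<phi> ^^ n = comp_operator (\<phi> ^^ n)"
  by (rule ext) (simp only: comp_operator_funpow comp_operator_def)

lemma norm_funpow_le:
  fixes \<phi> :: "'a::complex_banach \<Rightarrow> 'a"
  assumes \<phi>: "\<phi> \<in> HL0" and bound: "\<And>x. norm x < 1 \<Longrightarrow> norm (\<phi> x) < c"
    and c: "0 < c" "c < 1" and x: "norm x < 1"
  shows "norm ((\<phi> ^^ n) x) \<le> c ^ n * norm x"
proof (induction n)
  case (Suc n)
  have "c ^ n * norm x \<le> 1 * norm x"
    using c by (intro mult_right_mono power_le_one) auto
  then have "norm ((\<phi> ^^ n) x) < 1"
    using Suc x by simp
  then have "norm (\<phi> ((\<phi> ^^ n) x)) \<le> c * norm ((\<phi> ^^ n) x)"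
    using \<phi> bound by (intro holomorphic_map_Schwarz) (auto simp: HL0_def)
  also have "\<dots> \<le> c * (c ^ n * norm x)"
    using Suc c by (intro mult_left_mono) auto
  finally show ?case by (simp add: mult.assoc)
qed simp

lemma lip_const_funpow_Suc_le:
  fixes \<phi> :: "'a::complex_banach \<Rightarrow> 'a"
  assumes \<phi>: "\<phi> \<in> HL0" "\<phi> ` ball 0 1 \<subseteq> ball 0 1"
    and bound: "\<And>x. norm x < 1 \<Longrightarrow> norm (\<phi> x) < c" and c: "0 < c" "c < 1"
  shows "lip_const (\<phi> ^^ Suc n) \<le> c ^ n / (1 - c) * lip_const \<phi>"
proof -
  have small: "norm ((\<phi> ^^ n) x) \<le> c ^ n" if "norm x < 1" for x
  proof -
    have "c ^ n * norm x \<le> c ^ n * 1"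
      using c that by (intro mult_left_mono) auto
    then show ?thesis
      using norm_funpow_le[OF \<phi>(1) bound c that, of n] by simp
  qed
  have "holomorphic_map_on (\<phi> ^^ n) (ball 0 1)"
    using funpow_HL0[OF \<phi>, of n] by (auto simp: HL0_def)
  from holomorphic_map_lipschitz_on_ball[OF this small c(2)]
  have "(c ^ n / (1 - c))-lipschitz_on (\<phi> ` ball 0 1) (\<phi> ^^ n)"
    by (rule lipschitz_on_subset) (use bound in auto)
  from lip_const_le[OF lipschitz_on_compose[OF lipschitz_on_lip_const[OF \<phi>(1)] this]]
  show ?thesis
    by (simp only: funpow_Suc_right)
qed

theorem theorem5p3:
  fixes \<phi> :: "'a::complex_banach \<Rightarrow> 'a"
  assumes "\<phi> \<in> HL0"
    and "\<phi> ` ball 0 1 \<subseteq> ball 0 1"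
    and "ball_sup_norm \<phi> < 1"
  shows "(\<lambda>n. lip_const (\<phi> ^^ n)) \<longlonglongrightarrow> 0
    \<and> (\<lambda>n. HL0_onorm (comp_operator \<phi> ^^ n)) \<longlonglongrightarrow> 0"
proof -
  have le_sup: "norm (\<phi> x) \<le> ball_sup_norm \<phi>" if "norm x < 1" for x
    unfolding ball_sup_norm_def
  proof (rule cSUP_upper)
    show "bdd_above ((\<lambda>x. norm (\<phi> x)) ` ball 0 1)"
      using assms(2) by (intro bdd_aboveI2[where M = 1]) (force simp: image_subset_iff)
  qed (use that in simp)
  \<comment> \<open>Schwarz's lemma and the estimate on the smaller ball need a strict bound, hence the room
    between the supremum and \<open>c\<close>.\<close>
  obtain c where c: "ball_sup_norm \<phi> < c" "c < 1"
    using dense[OF assms(3)] by blast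
  have c0: "0 < c"
    using order_trans[OF norm_ge_zero le_sup[of 0]] c(1) by simp
  have bound: "norm (\<phi> x) < c" if "norm x < 1" for x
    using le_sup[OF that] c(1) by simp
  have pow: "\<phi> ^^ n \<in> HL0" "(\<phi> ^^ n) ` ball 0 1 \<subseteq> ball 0 1" for n
    using funpow_HL0[OF assms(1,2)] by auto
  have "(\<lambda>n. c ^ n / (1 - c) * lip_const \<phi>) \<longlonglongrightarrow> 0 / (1 - c) * lip_const \<phi>"
    using c c0 by (intro tendsto_intros LIMSEQ_realpow_zero) auto
  then have "(\<lambda>n. c ^ n / (1 - c) * lip_const \<phi>) \<longlonglongrightarrow> 0"
    by (simp only: div_0 mult_zero_left)
  from tendsto_sandwich[OF _ _ tendsto_const this]
  have "(\<lambda>n. lip_const (\<phi> ^^ Suc n)) \<longlonglongrightarrow> 0"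
    using lip_const_nonneg[OF pow(1)] lip_const_funpow_Suc_le[OF assms(1,2) bound c0 c(2)]
    by (meson always_eventually)
  then have lim: "(\<lambda>n. lip_const (\<phi> ^^ n)) \<longlonglongrightarrow> 0"
    by (rule LIMSEQ_imp_Suc)
  moreover have "(\<lambda>n. HL0_onorm (comp_operator \<phi> ^^ n)) \<longlonglongrightarrow> 0"
    unfolding comp_operator_power
    using HL0_onorm_comp_operator[OF pow]
    by (intro tendsto_sandwich[OF _ _ tendsto_const lim] always_eventually allI)
  ultimately show ?thesis ..
qed

end
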